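(* $\mathrm{ex}_<(n,P_5^{1324})=\Theta(n\log n)$.
   Context: Edge-ordered graph: finite simple graph with a linear order on its edges; isomorphisms preserve order; subgraphs carry induced order; $\mathrm{ex}_<(n,H)$ is the maximum number of edges of an edge-ordered graph on $n$ vertices with no subgraph isomorphic to $H$. Notation: $P_k^{a_1\dots a_{k-1}}$ is the path $v_1\dots v_k$ where edge $v_iv_{i+1}$ has label $a_i$ and edges are ordered by label. *)

theory Defs
  imports "HOL-Library.Landau_Symbols"
begin

record 'a eograph =
  verts :: "'a set"
  edges :: "'a set set"
  edge_le :: "'a set rel"

text \<open>Edges are two-element vertex sets, so graphs are simple. The field \<open>edge_le\<close> is the
  reflexive version of the linear order on the edges.\<close>

definition edge_ordered_graph :: "'a eograph \<Rightarrow> bool" where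
  "edge_ordered_graph G \<longleftrightarrow>
     finite (verts G) \<and>
     edges G \<subseteq> {e. e \<subseteq> verts G \<and> card e = 2} \<and>
     linear_order_on (edges G) (edge_le G)"

definition eo_isomorphic :: "'a eograph \<Rightarrow> 'b eograph \<Rightarrow> bool" where
  "eo_isomorphic G H \<longleftrightarrow>
     (\<exists>f. bij_betw f (verts G) (verts H) \<and>
          (\<forall>u\<in>verts G. \<forall>v\<in>verts G. {u, v} \<in> edges G \<longleftrightarrow> {f u, f v} \<in> edges H) \<and>
          (\<forall>e\<in>edges G. \<forall>e'\<in>edges G. (e, e') \<in> edge_le G \<longleftrightarrow> (f ` e, f ` e') \<in> edge_le H))"

definition eo_subgraph :: "'a eograph \<Rightarrow> 'a eograph \<Rightarrow> bool" where
  "eo_subgraph K G \<longleftrightarrow>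
     edge_ordered_graph K \<and> verts K \<subseteq> verts G \<and> edges K \<subseteq> edges G \<and>
     edge_le K = Restr (edge_le G) (edges K)"

definition eo_contains :: "'a eograph \<Rightarrow> 'b eograph \<Rightarrow> bool" where
  "eo_contains G H \<longleftrightarrow> (\<exists>K. eo_subgraph K G \<and> eo_isomorphic K H)"

text \<open>Every finite graph has an isomorphic copy with vertices in \<^typ>\<open>nat\<close>, so letting \<open>G\<close>
  range over graphs of that type is no restriction. If \<open>H\<close> has an edge, the maximum is over a
  finite nonempty set (see \<open>finite_H_free_edge_counts\<close> and \<open>H_free_edge_counts_nonempty\<close>).\<close>

definition H_free_edge_counts :: "nat \<Rightarrow> 'b eograph \<Rightarrow> nat set" where
  "H_free_edge_counts n H =
     {card (edges G) | G :: nat eograph.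
        edge_ordered_graph G \<and> card (verts G) = n \<and> \<not> eo_contains G H}"

definition ex_eo :: "nat \<Rightarrow> 'b eograph \<Rightarrow> nat" where
  "ex_eo n H = Max (H_free_edge_counts n H)"

text \<open>For distinct labels \<open>as = [a\<^sub>1, \<dots>, a\<^sub>k\<^sub>-\<^sub>1]\<close> this is the path \<open>P\<^sub>k\<close> labelled by \<open>as\<close>.
  Indices are shifted by one: the vertex \<open>v\<^sub>i\<close> is the number \<open>i - 1\<close>.\<close>

definition labelled_path :: "nat list \<Rightarrow> nat eograph" where
  "labelled_path as =
     \<lparr>verts = {..length as},
      edges = {{i, Suc i} | i. i < length as},
      edge_le = {({i, Suc i}, {j, Suc j}) | i j.
                   i < length as \<and> j < length as \<and> as ! i \<le> as ! j}\<rparr>"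

lemma finite_H_free_edge_counts: "finite (H_free_edge_counts n H)"
proof -
  have "card (edges G) \<le> n choose 2"
    if "edge_ordered_graph G" "card (verts G) = n" for G :: "nat eograph"
  proof -
    from that have fin: "finite (verts G)"
      and sub: "edges G \<subseteq> {e. e \<subseteq> verts G \<and> card e = 2}"
      by (auto simp: edge_ordered_graph_def)
    have "card (edges G) \<le> card {e. e \<subseteq> verts G \<and> card e = 2}"
      by (rule card_mono) (use fin sub in auto)
    then show ?thesis
      using n_subsets[OF fin, of 2] that by simp
  qed
  then have "H_free_edge_counts n H \<subseteq> {..n choose 2}"
    by (auto simp: H_free_edge_counts_def)
  then show ?thesis
    using finite_subset by blast
qed

lemma H_free_edge_counts_nonempty:
  assumes "edge_ordered_graph H" "edges H \<noteq> {}"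
  shows "H_free_edge_counts n H \<noteq> {}"
proof -
  define G :: "nat eograph" where "G = \<lparr>verts = {..<n}, edges = {}, edge_le = {}\<rparr>"
  have "edge_ordered_graph G"
    by (simp add: G_def edge_ordered_graph_def)
  moreover have "\<not> eo_contains G H"
  proof
    assume "eo_contains G H"
    then obtain K where sub: "eo_subgraph K G" and iso: "eo_isomorphic K H"
      unfolding eo_contains_def by blast
    have K: "edges K = {}"
      using sub by (simp add: eo_subgraph_def G_def)
    obtain f where f: "bij_betw f (verts K) (verts H)"
      and adj: "\<forall>u\<in>verts K. \<forall>v\<in>verts K. {u, v} \<in> edges K \<longleftrightarrow> {f u, f v} \<in> edges H"
      using iso unfolding eo_isomorphic_def by blast
    obtain d where d: "d \<in> edges H"
      using assms(2) by blast
    then have "d \<subseteq> verts H" "card d = 2"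
      using assms(1) by (auto simp: edge_ordered_graph_def)
    then obtain x y where xy: "d = {x, y}" "x \<in> f ` verts K" "y \<in> f ` verts K"
      using f by (auto simp: card_2_iff bij_betw_def)
    with adj K d show False
      by auto
  qed
  moreover have "card (verts G) = n"
    by (simp add: G_def)
  ultimately show ?thesis
    unfolding H_free_edge_counts_def by blast
qed

lemma edge_ordered_graph_labelled_path:
  assumes "distinct as"
  shows "edge_ordered_graph (labelled_path as)"
proof -
  define e where "e = (\<lambda>i::nat. {i, Suc i})"
  have inj: "e i = e j \<longleftrightarrow> i = j" for i j
    by (auto simp: e_def doubleton_eq_iff)
  have E: "edges (labelled_path as) = {e i | i. i < length as}"
    by (simp add: labelled_path_def e_def)
  have L: "edge_le (labelled_path as) =
      {(e i, e j) | i j. i < length as \<and> j < length as \<and> as ! i \<le> as ! j}"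
    by (simp add: labelled_path_def e_def)
  have "linear_order_on (edges (labelled_path as)) (edge_le (labelled_path as))"
    unfolding order_on_defs
  proof (intro conjI)
    show "antisym (edge_le (labelled_path as))"
      using assms by (auto simp: L inj antisym_def nth_eq_iff_index_eq dest: order_antisym)
  qed (auto simp: E L inj refl_on_def trans_def total_on_def)
  then show ?thesis
    by (auto simp: edge_ordered_graph_def labelled_path_def)
qed

end

theory Submission
  imports Defs
begin

text \<open>
  Upper bound. The path has a centre \<open>v\<close> with edges \<open>c = vx < b = vy\<close>, an edge at \<open>y\<close> before \<open>c\<close> and
  an edge at \<open>x\<close> after \<open>b\<close>. After twice deleting the first and the last edge at every vertex, the five
  vertices are automatically distinct, so for consecutive edges \<open>c < b\<close> at \<open>v\<close> either all edges at
  \<open>x\<close> precede \<open>b\<close> or all edges at \<open>y\<close> follow \<open>c\<close>. Every vertex contributes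
  at least as many of these alternatives as its degree, and apart from \<open>O(n)\<close> edges each of the two
  kinds holds at no more than one end of an edge; so the number of edges is \<open>O(n)\<close> plus the number
  of edges with both kinds. Both can occur at the same end only \<open>O(n)\<close> times. Otherwise, with edges
  identified with their ranks, all edges at \<open>x\<close> precede the next edge at \<open>y\<close> and all edges at \<open>y\<close> follow the
  previous edge at \<open>x\<close>; then a distance to the first edge at \<open>y\<close> or to the last edge at \<open>x\<close> doubles,
  which happens \<open>O(log n)\<close> times per vertex.

  Lower bound. Join \<open>x\<^sub>i\<close> to \<open>y\<^sub>j\<close> if \<open>j = i - 2\<^sup>t\<close> and the binary digit \<open>t\<close> of \<open>i\<close> is \<open>1\<close>, and order
  the edges by \<open>i\<close> with its \<open>t\<close> lowest digits cleared, then by \<open>i\<close>. Recursively: the edges inside the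
  lower half come first, then a matching between the halves, then the edges inside the upper half.
\<close>

lemma card_UN_le_mult:
  assumes "finite V" "\<And>v. v \<in> V \<Longrightarrow> card (F v) \<le> k"
  shows "card (\<Union>v\<in>V. F v) \<le> card V * k"
proof -
  have "card (\<Union>v\<in>V. F v) \<le> (\<Sum>v\<in>V. card (F v))"
    by (rule card_UN_le[OF assms(1)])
  also have "\<dots> \<le> card V * k"
    using sum_bounded_above[of V "\<lambda>v. card (F v)" k] assms(2) by simp
  finally show ?thesis .
qed

lemma card_doubling_le:
  fixes A :: "nat set"
  assumes "finite A" "A \<noteq> {}" "\<And>a b. a \<in> A \<Longrightarrow> b \<in> A \<Longrightarrow> a < b \<Longrightarrow> 2 * a < b"
  shows "2 ^ card A \<le> 2 * Suc (Max A)"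
  using assms
proof (induction A rule: finite_linorder_max_induct)
  case empty
  then show ?case by simp
next
  case (insert b A)
  show ?case
  proof (cases "A = {}")
    case False
    have "2 ^ card A \<le> 2 * Suc (Max A)"
      by (rule insert.IH) (use False insert.prems in auto)
    moreover have "2 * Max A < b"
      using insert.prems insert.hyps False by auto
    moreover have "Max (insert b A) = b"
      using insert.hyps by (intro Max_eqI) (auto intro: less_imp_le)
    moreover have "card (insert b A) = Suc (card A)"
      using insert.hyps by (subst card_insert_disjoint) auto
    ultimately show ?thesis by simp
  qed simp
qed

lemma card_arcs:
  assumes "finite F" "\<And>e. e \<in> F \<Longrightarrow> card e = 2"
  shows "card {(v, w). {v, w} \<in> F} = 2 * card F"
proof -
  define D where "D e = {(v, w). {v, w} = e}" for e :: "'a set"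
  have D: "finite (D e)" "card (D e) = 2" if "e \<in> F" for e
  proof -
    obtain x y where xy: "e = {x, y}" "x \<noteq> y"
      using assms(2)[OF \<open>e \<in> F\<close>] by (auto simp: card_2_iff)
    then have "D e = {(x, y), (y, x)}"
      by (auto simp: D_def doubleton_eq_iff)
    then show "finite (D e)" "card (D e) = 2"
      using xy by auto
  qed
  have "{(v, w). {v, w} \<in> F} = (\<Union>e\<in>F. D e)"
    by (auto simp: D_def)
  also have "card \<dots> = (\<Sum>e\<in>F. card (D e))"
    by (rule card_UN_disjoint) (use assms D in \<open>auto simp: D_def\<close>)
  also have "\<dots> = 2 * card F"
    using D by simp
  finally show ?thesis .
qed

lemma card_le_1_if_eq:
  assumes "\<And>x y. x \<in> A \<Longrightarrow> y \<in> A \<Longrightarrow> x = y"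
  shows "card A \<le> 1"
  by (metis assms card_eq_0_iff card_le_Suc0_iff_eq One_nat_def zero_le_one)

subsection \<open>Edge sets with injective labels\<close>

locale labelled_edge_set =
  fixes V :: "'a set" and E :: "'a set set" and lab :: "'a set \<Rightarrow> nat"
  assumes finite_V: "finite V"
    and edge_subset: "e \<in> E \<Longrightarrow> e \<subseteq> V"
    and card_edge: "e \<in> E \<Longrightarrow> card e = 2"
    and inj_lab: "inj_on lab E"
begin

lemma finite_E: "finite E"
  by (rule finite_subset[of _ "Pow V"]) (use finite_V edge_subset in auto)

lemma lab_eq_iff: "e \<in> E \<Longrightarrow> f \<in> E \<Longrightarrow> lab e = lab f \<longleftrightarrow> e = f"
  using inj_lab by (auto simp: inj_on_def)

lemma edge_ne: "{v, w} \<in> E \<Longrightarrow> v \<noteq> w"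
  using card_edge by force

lemma edge_obtain_other:
  assumes "e \<in> E" "v \<in> e"
  obtains w where "e = {v, w}" "v \<noteq> w"
  using card_edge[OF assms(1)] assms(2) by (auto simp: card_2_iff insert_commute)

definition extremal :: "'a set set" where
  "extremal = {e \<in> E. \<exists>w\<in>e. (\<forall>f\<in>E. w \<in> f \<longrightarrow> lab e \<le> lab f) \<or> (\<forall>f\<in>E. w \<in> f \<longrightarrow> lab f \<le> lab e)}"

lemma nonextremal:
  assumes "e \<in> E - extremal" "w \<in> e"
  obtains f g where "f \<in> E" "w \<in> f" "lab f < lab e" "g \<in> E" "w \<in> g" "lab e < lab g"
  using assms unfolding extremal_def by (auto simp: not_le)

lemma card_extremal_le: "card extremal \<le> 2 * card V"
proof -
  define F where "F w = {e \<in> E. w \<in> e \<and> (\<forall>f\<in>E. w \<in> f \<longrightarrow> lab e \<le> lab f)}" for w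
  define L where "L w = {e \<in> E. w \<in> e \<and> (\<forall>f\<in>E. w \<in> f \<longrightarrow> lab f \<le> lab e)}" for w
  have F: "card (F w) \<le> 1" for w
    by (rule card_le_1_if_eq) (auto simp: F_def lab_eq_iff[symmetric] intro: order_antisym)
  have L: "card (L w) \<le> 1" for w
    by (rule card_le_1_if_eq) (auto simp: L_def lab_eq_iff[symmetric] intro: order_antisym)
  have fin: "finite ((\<Union>w\<in>V. F w) \<union> (\<Union>w\<in>V. L w))"
    by (rule finite_subset[OF _ finite_E]) (auto simp: F_def L_def)
  have "extremal \<subseteq> (\<Union>w\<in>V. F w) \<union> (\<Union>w\<in>V. L w)"
    using edge_subset by (fastforce simp: extremal_def F_def L_def)
  then have "card extremal \<le> card ((\<Union>w\<in>V. F w) \<union> (\<Union>w\<in>V. L w))"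
    by (rule card_mono[OF fin])
  also have "\<dots> \<le> card V * 1 + card V * 1"
    using card_UN_le_mult[OF finite_V, of F 1] card_UN_le_mult[OF finite_V, of L 1] F L
    by (intro order_trans[OF card_Un_le] add_mono) auto
  finally show ?thesis by simp
qed

lemma card_E_le: "card E \<le> card (E - extremal) + 2 * card V"
proof -
  have "card (E - extremal) = card E - card extremal"
    by (rule card_Diff_subset) (auto simp: extremal_def intro: finite_subset[OF _ finite_E])
  then show ?thesis
    using card_extremal_le by linarith
qed

lemma labelled_edge_set_subset: "E' \<subseteq> E \<Longrightarrow> labelled_edge_set V E' lab"
  by unfold_locales
    (use finite_V edge_subset card_edge inj_lab in \<open>auto intro: inj_on_subset\<close>)

end

locale non_interlacing_edge_set = labelled_edge_set +
  assumes non_interlacing: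
    "\<lbrakk>{v, x} \<in> E; {v, y} \<in> E; lab {v, x} < lab {v, y};
      a \<in> E; y \<in> a; lab a < lab {v, x}; d \<in> E; x \<in> d; lab {v, y} < lab d\<rbrakk> \<Longrightarrow> False"
begin

definition ends_before_next :: "'a \<Rightarrow> 'a \<Rightarrow> bool" where
  "ends_before_next v w \<longleftrightarrow>
     (\<forall>d\<in>E. \<forall>f\<in>E. w \<in> d \<longrightarrow> v \<in> f \<longrightarrow> lab {v, w} < lab f \<longrightarrow> lab d < lab f)"

definition starts_after_prev :: "'a \<Rightarrow> 'a \<Rightarrow> bool" where
  "starts_after_prev v w \<longleftrightarrow>
     (\<forall>d\<in>E. \<forall>f\<in>E. w \<in> d \<longrightarrow> v \<in> f \<longrightarrow> lab f < lab {v, w} \<longrightarrow> lab f < lab d)"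

lemma consecutive_edges:
  assumes e: "{v, w} \<in> E" and n: "\<not> ends_before_next v w"
  obtains u where "{v, u} \<in> E" "starts_after_prev v u" "lab {v, w} < lab {v, u}"
    "\<And>f. f \<in> E \<Longrightarrow> v \<in> f \<Longrightarrow> lab {v, w} < lab f \<Longrightarrow> lab {v, u} \<le> lab f"
proof -
  obtain d f where df: "d \<in> E" "f \<in> E" "w \<in> d" "v \<in> f" "lab {v, w} < lab f" "lab f \<le> lab d"
    using n by (auto simp: ends_before_next_def not_less)
  obtain g where g: "g \<in> E \<and> v \<in> g \<and> lab {v, w} < lab g"
    and g_min: "\<And>f. f \<in> E \<and> v \<in> f \<and> lab {v, w} < lab f \<Longrightarrow> lab g \<le> lab f"
    using ex_has_least_nat[of "\<lambda>f. f \<in> E \<and> v \<in> f \<and> lab {v, w} < lab f" f lab] df by blast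
  obtain u where u: "g = {v, u}" "v \<noteq> u"
    using g edge_obtain_other by blast
  have "w \<noteq> v" "w \<noteq> u"
    using edge_ne[OF e] g u by auto
  have "lab g \<le> lab d"
    using g_min[of f] df by linarith
  moreover have "d \<noteq> g"
    using df u \<open>w \<noteq> v\<close> \<open>w \<noteq> u\<close> by auto
  ultimately have gd: "lab g < lab d"
    using lab_eq_iff[of g d] df g by force
  have "starts_after_prev v u"
    unfolding starts_after_prev_def
  proof (intro ballI impI, rule ccontr)
    fix a h
    assume ah: "a \<in> E" "h \<in> E" "u \<in> a" "v \<in> h" "lab h < lab {v, u}" "\<not> lab h < lab a"
    have "lab h \<le> lab {v, w}"
      using g_min[of h] ah u by force
    then have "lab a \<le> lab {v, w}"
      using ah by linarith
    moreover have "a \<noteq> {v, w}"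
      using ah u \<open>w \<noteq> u\<close> by auto
    ultimately have "lab a < lab {v, w}"
      using lab_eq_iff[of a "{v, w}"] ah e by force
    then show False
      using non_interlacing[of v w u a d] e g u ah df gd by auto
  qed
  then show ?thesis
    using that[of u] g u g_min by auto
qed

lemma twice_card_E_le:
  "2 * card E \<le> card {(v, w). {v, w} \<in> E \<and> ends_before_next v w}
              + card {(v, w). {v, w} \<in> E \<and> starts_after_prev v w}"
    (is "_ \<le> card ?R + card ?L")
proof -
  define A where "A = {(v, w). {v, w} \<in> E}"
  have A: "card A = 2 * card E"
    unfolding A_def by (rule card_arcs[OF finite_E card_edge])
  have finA: "finite A"
    by (rule finite_subset[of _ "V \<times> V"]) (use edge_subset finite_V in \<open>auto simp: A_def\<close>)
  have sub: "?R \<subseteq> A" "?L \<subseteq> A"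
    by (auto simp: A_def)
  define P where "P p q \<longleftrightarrow> q \<in> ?L \<and> fst q = fst p \<and> lab {fst p, snd p} < lab {fst q, snd q} \<and>
     (\<forall>f\<in>E. fst p \<in> f \<longrightarrow> lab {fst p, snd p} < lab f \<longrightarrow> lab {fst q, snd q} \<le> lab f)" for p q
  have "\<exists>q. P p q" if pA: "p \<in> A - ?R" for p
  proof -
    obtain v w where p: "p = (v, w)" "{v, w} \<in> E" "\<not> ends_before_next v w"
      using pA by (auto simp: A_def)
    obtain u where "{v, u} \<in> E" "starts_after_prev v u" "lab {v, w} < lab {v, u}"
      "\<And>f. f \<in> E \<Longrightarrow> v \<in> f \<Longrightarrow> lab {v, w} < lab f \<Longrightarrow> lab {v, u} \<le> lab f"
      using consecutive_edges[OF p(2,3)] by blast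
    then show ?thesis
      using p(1) by (intro exI[of _ "(v, u)"]) (simp add: P_def)
  qed
  then have "\<exists>nxt. \<forall>p\<in>A - ?R. P p (nxt p)"
    by (intro bchoice ballI)
  then obtain nxt where nxt: "\<And>p. p \<in> A - ?R \<Longrightarrow> P p (nxt p)"
    by blast
  have "inj_on nxt (A - ?R)"
  proof (rule inj_onI)
    fix p q assume pq: "p \<in> A - ?R" "q \<in> A - ?R" "nxt p = nxt q"
    obtain v w v' w' where vw: "p = (v, w)" "q = (v', w')" "{v, w} \<in> E" "{v', w'} \<in> E"
      using pq by (auto simp: A_def)
    have Pp: "P p (nxt p)" and Pq: "P q (nxt p)"
      using nxt[of p] nxt[of q] pq by auto
    have v: "v = v'"
      using Pp Pq vw by (simp add: P_def)
    have min: "lab {v, w} < lab {fst (nxt p), snd (nxt p)}"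
      "lab {v, w'} < lab {fst (nxt p), snd (nxt p)}"
      "\<And>f. f \<in> E \<Longrightarrow> v \<in> f \<Longrightarrow> lab {v, w} < lab f \<Longrightarrow> lab {fst (nxt p), snd (nxt p)} \<le> lab f"
      "\<And>f. f \<in> E \<Longrightarrow> v \<in> f \<Longrightarrow> lab {v, w'} < lab f \<Longrightarrow> lab {fst (nxt p), snd (nxt p)} \<le> lab f"
      using Pp Pq unfolding P_def vw(1,2) v fst_conv snd_conv by blast+
    have "\<not> lab {v, w} < lab {v', w'}" "\<not> lab {v', w'} < lab {v, w}"
      using min(1,2) min(3)[of "{v', w'}"] min(4)[of "{v, w}"] vw(3,4) v by (auto simp: not_le[symmetric])
    then have "{v, w} = {v', w'}"
      using lab_eq_iff vw by (metis linorder_neqE_nat)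
    then show "p = q"
      using vw v by (auto simp: doubleton_eq_iff)
  qed
  moreover have "nxt ` (A - ?R) \<subseteq> ?L"
  proof (rule image_subsetI)
    fix p assume "p \<in> A - ?R"
    from nxt[OF this] show "nxt p \<in> ?L"
      unfolding P_def by (rule conjunct1)
  qed
  ultimately have "card (A - ?R) \<le> card ?L"
    by (rule card_inj_on_le) (rule finite_subset[OF sub(2) finA])
  moreover have "card A = card ?R + card (A - ?R)"
    using card_Diff_subset[OF finite_subset[OF sub(1) finA] sub(1)] card_mono[OF finA sub(1)]
    by linarith
  ultimately show ?thesis
    using A by linarith
qed

lemma not_ends_before_next_both:
  assumes "{v, w} \<in> E - extremal" "ends_before_next v w"
  shows "\<not> ends_before_next w v"
proof
  assume "ends_before_next w v"
  obtain f where f: "f \<in> E" "v \<in> f" "lab {v, w} < lab f"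
    using nonextremal[OF assms(1), of v] by auto
  obtain g where g: "g \<in> E" "w \<in> g" "lab {w, v} < lab g"
    using nonextremal[OF assms(1), of w] by (auto simp: insert_commute)
  have "lab g < lab f" "lab f < lab g"
    using assms(2) \<open>ends_before_next w v\<close> f g by (auto simp: ends_before_next_def)
  then show False by simp
qed

lemma not_starts_after_prev_both:
  assumes "{v, w} \<in> E - extremal" "starts_after_prev v w"
  shows "\<not> starts_after_prev w v"
proof
  assume "starts_after_prev w v"
  obtain f where f: "f \<in> E" "v \<in> f" "lab f < lab {v, w}"
    using nonextremal[OF assms(1), of v] by auto
  obtain g where g: "g \<in> E" "w \<in> g" "lab g < lab {w, v}"
    using nonextremal[OF assms(1), of w] by (auto simp: insert_commute)
  have "lab g < lab f" "lab f < lab g"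
    using assms(2) \<open>starts_after_prev w v\<close> f g by (auto simp: starts_after_prev_def)
  then show False by simp
qed

lemma card_arcs_le:
  assumes asym: "\<And>v w. {v, w} \<in> E - extremal \<Longrightarrow> Q v w \<Longrightarrow> \<not> Q w v"
  shows "card {(v, w). {v, w} \<in> E \<and> Q v w}
    \<le> 4 * card V + card {e \<in> E - extremal. \<exists>v w. e = {v, w} \<and> Q v w}"
    (is "card ?A \<le> _ + card ?B")
proof -
  have ext: "extremal \<subseteq> E"
    by (auto simp: extremal_def)
  define X where "X = {(v, w). {v, w} \<in> extremal}"
  define A0 where "A0 = {(v, w). {v, w} \<in> E - extremal \<and> Q v w}"
  have "card X = 2 * card extremal"
    unfolding X_def
    by (rule card_arcs) (use ext card_edge finite_subset[OF ext finite_E] in auto)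
  then have X: "card X \<le> 4 * card V"
    using card_extremal_le by linarith
  have "finite (X \<union> A0)"
    by (rule finite_subset[of _ "V \<times> V"])
      (use edge_subset finite_V ext in \<open>auto simp: X_def A0_def\<close>)
  moreover have "?A \<subseteq> X \<union> A0"
    by (auto simp: X_def A0_def)
  ultimately have "card ?A \<le> card X + card A0"
    using card_mono card_Un_le order_trans by meson
  moreover have "card A0 \<le> card ?B"
  proof (rule card_inj_on_le[where f = "\<lambda>(v, w). {v, w}"])
    show "inj_on (\<lambda>(v, w). {v, w}) A0"
      using asym by (auto simp: inj_on_def A0_def doubleton_eq_iff insert_commute)
    show "(\<lambda>(v, w). {v, w}) ` A0 \<subseteq> ?B"
      by (auto simp: A0_def)
    show "finite ?B"
      using finite_E by auto
  qed
  ultimately show ?thesis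
    using X by linarith
qed

lemma card_enclosed_le:
  "card {e \<in> E - extremal. \<exists>v w. e = {v, w} \<and> ends_before_next v w \<and> starts_after_prev v w}
    \<le> card V"
proof -
  define T where "T w = {e \<in> E - extremal. \<exists>v. e = {v, w} \<and>
    ends_before_next v w \<and> starts_after_prev v w}" for w
  have no: "\<not> lab {v, w} < lab {v', w}" if "{v, w} \<in> T w" "{v', w} \<in> T w"
    "ends_before_next v w" "starts_after_prev v' w" for v v' w
  proof
    assume less: "lab {v, w} < lab {v', w}"
    have E: "{v, w} \<in> E - extremal" "{v', w} \<in> E - extremal"
      using that by (auto simp: T_def)
    obtain f where f: "f \<in> E" "v \<in> f" "lab {v, w} < lab f"
      using nonextremal[OF E(1), of v] by auto
    obtain g where g: "g \<in> E" "v' \<in> g" "lab g < lab {v', w}"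
      using nonextremal[OF E(2), of v'] by auto
    have "lab {v', w} < lab f"
      using that(3) f E by (auto simp: ends_before_next_def)
    moreover have "lab g < lab {v, w}"
      using that(4) g E by (auto simp: starts_after_prev_def)
    ultimately show False
      using non_interlacing[of w v v' g f] less E f g by (simp add: insert_commute)
  qed
  have "card (T w) \<le> 1" for w
  proof (rule card_le_1_if_eq)
    fix e e' assume e: "e \<in> T w" "e' \<in> T w"
    obtain v v' where v: "e = {v, w}" "e' = {v', w}" "ends_before_next v w" "starts_after_prev v w"
      "ends_before_next v' w" "starts_after_prev v' w"
      using e by (auto simp: T_def)
    have "\<not> lab e < lab e'" "\<not> lab e' < lab e"
      using no[of v w v'] no[of v' w v] e v by auto
    then show "e = e'"
      using e lab_eq_iff[of e e'] by (auto simp: T_def)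
  qed
  then have "card (\<Union>w\<in>V. T w) \<le> card V"
    using card_UN_le_mult[OF finite_V, of T 1] by simp
  moreover have "card {e \<in> E - extremal. \<exists>v w. e = {v, w} \<and> ends_before_next v w \<and>
      starts_after_prev v w} \<le> card (\<Union>w\<in>V. T w)"
    by (rule card_mono) (use edge_subset finite_E finite_V in \<open>auto simp: T_def\<close>)
  ultimately show ?thesis by linarith
qed

text \<open>For such an edge \<open>e = {x, y}\<close> the distance from the first label at \<open>y\<close> to \<open>e\<close> or the distance
  from \<open>e\<close> to the last label at \<open>x\<close> doubles when passing to the neighbouring edge at \<open>y\<close> or \<open>x\<close>.\<close>

lemma card_crossing_le:
  assumes N: "\<And>e. e \<in> E \<Longrightarrow> lab e < N" and K: "N < 2 ^ K"
  shows "card {e \<in> E. \<exists>x y. e = {x, y} \<and> ends_before_next y x \<and> starts_after_prev x y}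
    \<le> 2 * card V * K" (is "card ?C \<le> _")
proof -
  define fst_lab where "fst_lab v = Min (lab ` {f \<in> E. v \<in> f})" for v
  define lst_lab where "lst_lab v = Max (lab ` {f \<in> E. v \<in> f})" for v
  have fst_le: "fst_lab v \<le> lab f" and le_lst: "lab f \<le> lst_lab v" if "f \<in> E" "v \<in> f" for v f
    using that finite_E by (auto simp: fst_lab_def lst_lab_def)
  have fst_in: "\<exists>f\<in>E. v \<in> f \<and> lab f = fst_lab v" and lst_in: "\<exists>f\<in>E. v \<in> f \<and> lab f = lst_lab v"
    if "e \<in> E" "v \<in> e" for v e
  proof -
    have *: "finite (lab ` {f \<in> E. v \<in> f})" "lab ` {f \<in> E. v \<in> f} \<noteq> {}"
      using that finite_E by auto
    show "\<exists>f\<in>E. v \<in> f \<and> lab f = fst_lab v" "\<exists>f\<in>E. v \<in> f \<and> lab f = lst_lab v"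
      using Min_in[OF *] Max_in[OF *] by (auto simp: fst_lab_def lst_lab_def)
  qed
  have card_le: "card A \<le> K"
    if "A \<subseteq> E" "inj_on g A" "\<And>e. e \<in> A \<Longrightarrow> g e < N"
      "\<And>e f. e \<in> A \<Longrightarrow> f \<in> A \<Longrightarrow> g e < g f \<Longrightarrow> 2 * g e < g f"
    for A and g :: "'a set \<Rightarrow> nat"
  proof (cases "A = {}")
    case False
    have fin: "finite (g ` A)"
      using that finite_subset[OF _ finite_E] by auto
    have "2 ^ card (g ` A) \<le> 2 * Suc (Max (g ` A))"
      by (rule card_doubling_le) (use fin False that in auto)
    moreover have "Max (g ` A) < N"
      using fin False that by auto
    ultimately have "(2::nat) ^ card A < 2 ^ Suc K"
      using K card_image[OF that(2)] by simp
    then show ?thesis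
      by (simp only: power_strict_increasing_iff less_Suc_eq_le one_less_numeral_iff semiring_norm)
  qed simp
  define A where "A y = {e \<in> E. y \<in> e \<and>
    (\<forall>f\<in>E. y \<in> f \<longrightarrow> lab e < lab f \<longrightarrow> 2 * (lab e - fst_lab y) < lab f - fst_lab y)}" for y
  define B where "B x = {e \<in> E. x \<in> e \<and>
    (\<forall>f\<in>E. x \<in> f \<longrightarrow> lab f < lab e \<longrightarrow> 2 * (lst_lab x - lab e) < lst_lab x - lab f)}" for x
  have cA: "card (A y) \<le> K" for y
  proof (rule card_le[where g = "\<lambda>e. lab e - fst_lab y"])
    show "inj_on (\<lambda>e. lab e - fst_lab y) (A y)"
    proof (rule inj_onI)
      fix e f assume ef: "e \<in> A y" "f \<in> A y" "lab e - fst_lab y = lab f - fst_lab y"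
      then have "lab e = lab f"
        using fst_le[of e y] fst_le[of f y] by (auto simp: A_def)
      then show "e = f"
        using ef lab_eq_iff by (auto simp: A_def)
    qed
    show "lab e - fst_lab y < N" if "e \<in> A y" for e
      using that N[of e] by (auto simp: A_def)
  qed (auto simp: A_def)
  have cB: "card (B x) \<le> K" for x
  proof (rule card_le[where g = "\<lambda>e. lst_lab x - lab e"])
    show "inj_on (\<lambda>e. lst_lab x - lab e) (B x)"
    proof (rule inj_onI)
      fix e f assume ef: "e \<in> B x" "f \<in> B x" "lst_lab x - lab e = lst_lab x - lab f"
      then have "lab e = lab f"
        using le_lst[of e x] le_lst[of f x] by (auto simp: B_def)
      then show "e = f"
        using ef lab_eq_iff by (auto simp: B_def)
    qed
    show "lst_lab x - lab e < N" if eB: "e \<in> B x" for e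
    proof -
      obtain f where "f \<in> E" "lab f = lst_lab x"
        using lst_in[of e x] eB by (auto simp: B_def)
      then have "lst_lab x < N"
        using N[of f] by simp
      then show ?thesis by simp
    qed
  qed (auto simp: B_def)
  have "?C \<subseteq> (\<Union>y\<in>V. A y) \<union> (\<Union>x\<in>V. B x)"
  proof
    fix e assume "e \<in> ?C"
    then obtain x y where e: "e \<in> E" "e = {x, y}"
      and R: "ends_before_next y x" and L: "starts_after_prev x y"
      by auto
    have V: "x \<in> V" "y \<in> V"
      using edge_subset e by auto
    obtain d where d: "d \<in> E" "x \<in> d" "lab d = lst_lab x"
      using lst_in[of e x] e by auto
    obtain c where c: "c \<in> E" "y \<in> c" "lab c = fst_lab y"
      using fst_in[of e y] e by auto
    have y_le: "fst_lab y \<le> lab e" and x_le: "lab e \<le> lst_lab x"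
      using fst_le[of e y] le_lst[of e x] e by auto
    have after: "lst_lab x < lab f" if "f \<in> E" "y \<in> f" "lab e < lab f" for f
      using R that d e by (auto simp: ends_before_next_def insert_commute)
    have before: "lab f < fst_lab y" if "f \<in> E" "x \<in> f" "lab f < lab e" for f
      using L that c e by (auto simp: starts_after_prev_def)
    show "e \<in> (\<Union>y\<in>V. A y) \<union> (\<Union>x\<in>V. B x)"
    proof (cases "lab e - fst_lab y \<le> lst_lab x - lab e")
      case True
      then have "e \<in> A y"
        using e after y_le x_le unfolding A_def by fastforce
      then show ?thesis using V by auto
    next
      case False
      then have "e \<in> B x"
        using e before y_le x_le unfolding B_def by fastforce
      then show ?thesis using V by auto
    qed
  qed
  moreover have "finite ((\<Union>y\<in>V. A y) \<union> (\<Union>x\<in>V. B x))"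
    by (rule finite_subset[OF _ finite_E]) (auto simp: A_def B_def)
  ultimately have "card ?C \<le> card ((\<Union>y\<in>V. A y) \<union> (\<Union>x\<in>V. B x))"
    by (intro card_mono)
  also have "\<dots> \<le> card V * K + card V * K"
    using card_UN_le_mult[OF finite_V, of A K] card_UN_le_mult[OF finite_V, of B K] cA cB
    by (intro order_trans[OF card_Un_le] add_mono) auto
  finally show ?thesis by simp
qed

lemma card_E_le_log:
  assumes N: "\<And>e. e \<in> E \<Longrightarrow> lab e < N" and K: "N < 2 ^ K"
  shows "card E \<le> card V * (9 + 2 * K)"
proof -
  define R where "R = {e \<in> E - extremal. \<exists>v w. e = {v, w} \<and> ends_before_next v w}"
  define L where "L = {e \<in> E - extremal. \<exists>v w. e = {v, w} \<and> starts_after_prev v w}"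
  define T where "T = {e \<in> E - extremal. \<exists>v w. e = {v, w} \<and> ends_before_next v w \<and> starts_after_prev v w}"
  define C where "C = {e \<in> E. \<exists>x y. e = {x, y} \<and> ends_before_next y x \<and> starts_after_prev x y}"
  have fin: "finite R" "finite L" "finite T" "finite C"
    using finite_E by (auto simp: R_def L_def T_def C_def)
  have "2 * card E \<le> (4 * card V + card R) + (4 * card V + card L)"
    using twice_card_E_le card_arcs_le[of ends_before_next] card_arcs_le[of starts_after_prev]
      not_ends_before_next_both not_starts_after_prev_both
    unfolding R_def L_def by (meson add_mono order_trans)
  also have "card R + card L = card (R \<union> L) + card (R \<inter> L)"
    using card_Un_Int fin by blast
  then have "(4 * card V + card R) + (4 * card V + card L) = 8 * card V + card (R \<union> L) + card (R \<inter> L)"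
    by simp
  finally have 1: "2 * card E \<le> 8 * card V + card (R \<union> L) + card (R \<inter> L)" .
  have 2: "card (R \<union> L) \<le> card E"
    by (rule card_mono[OF finite_E]) (auto simp: R_def L_def)
  have "R \<inter> L \<subseteq> T \<union> C"
  proof
    fix e assume "e \<in> R \<inter> L"
    then obtain v w v' w' where e: "e \<in> E - extremal" "e = {v, w}" "e = {v', w'}"
      "ends_before_next v w" "starts_after_prev v' w'"
      unfolding R_def L_def by blast
    then consider "v' = v" "w' = w" | "v' = w" "w' = v"
      by (auto simp: doubleton_eq_iff)
    then show "e \<in> T \<union> C"
      using e unfolding T_def C_def by cases blast+
  qed
  then have "card (R \<inter> L) \<le> card (T \<union> C)"
    using fin by (intro card_mono) auto
  also have "\<dots> \<le> card T + card C"
    by (rule card_Un_le)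
  also have "\<dots> \<le> card V + 2 * card V * K"
    using card_enclosed_le card_crossing_le[OF N K] unfolding T_def C_def by (intro add_mono)
  finally show ?thesis
    using 1 2 by (simp add: algebra_simps)
qed

end

subsection \<open>Copies of the path\<close>

abbreviation (input) P5_1324 :: "nat eograph" where
  "P5_1324 \<equiv> labelled_path [1, 3, 2, 4]"

lemma P5_1324_simps:
  "verts P5_1324 = {0, 1, 2, 3, 4}"
  "edges P5_1324 = {{0, 1}, {1, 2}, {2, 3}, {3, 4}}"
  "edge_le P5_1324 =
     {({0, 1}, {0, 1}), ({0, 1}, {1, 2}), ({0, 1}, {2, 3}), ({0, 1}, {3, 4}),
      ({1, 2}, {1, 2}), ({1, 2}, {3, 4}),
      ({2, 3}, {1, 2}), ({2, 3}, {2, 3}), ({2, 3}, {3, 4}), ({3, 4}, {3, 4})}"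
proof -
  have less4: "(i < 4) = (i = 0 \<or> i = 1 \<or> i = 2 \<or> i = 3)" for i :: nat
    by auto
  have len: "length [1, 3, 2, 4 :: nat] = 4"
    by simp
  have ex: "(\<exists>i. i < (4::nat) \<and> Q i) = (Q 0 \<or> Q 1 \<or> Q 2 \<or> Q 3)" for Q
    by (auto simp: less4)
  have S: "Suc 0 = 1" "Suc 1 = 2" "Suc 2 = 3" "Suc 3 = 4"
    by simp_all
  have nth: "[1, 3, 2, 4 :: nat] ! 0 = 1" "[1, 3, 2, 4 :: nat] ! 1 = 3"
    "[1, 3, 2, 4 :: nat] ! 2 = 2" "[1, 3, 2, 4 :: nat] ! 3 = 4"
    by simp_all
  show "verts P5_1324 = {0, 1, 2, 3, 4}"
    by (auto simp: labelled_path_def)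
  have "edges P5_1324 = {e. \<exists>i<4. e = {i, Suc i}}"
    unfolding labelled_path_def len by auto
  then show "edges P5_1324 = {{0, 1}, {1, 2}, {2, 3}, {3, 4}}"
    unfolding ex S by (intro set_eqI) (simp only: insert_iff mem_Collect_eq empty_iff simp_thms)
  have "edge_le P5_1324 = {p. \<exists>i<4. \<exists>j<4. p = ({i, Suc i}, {j, Suc j}) \<and>
      [1, 3, 2, 4 :: nat] ! i \<le> [1, 3, 2, 4] ! j}"
    unfolding labelled_path_def len by auto
  then show "edge_le P5_1324 =
     {({0, 1}, {0, 1}), ({0, 1}, {1, 2}), ({0, 1}, {2, 3}), ({0, 1}, {3, 4}),
      ({1, 2}, {1, 2}), ({1, 2}, {3, 4}),
      ({2, 3}, {1, 2}), ({2, 3}, {2, 3}), ({2, 3}, {3, 4}), ({3, 4}, {3, 4})}"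
    unfolding ex S nth by (intro set_eqI) simp
qed

lemma eo_contains_P5_1324I:
  assumes G: "edge_ordered_graph G" and dist: "distinct [v1, v2, v3, v4, v5]"
    and E: "{v1, v2} \<in> edges G" "{v2, v3} \<in> edges G" "{v3, v4} \<in> edges G" "{v4, v5} \<in> edges G"
    and le: "({v1, v2}, {v3, v4}) \<in> edge_le G" "({v3, v4}, {v2, v3}) \<in> edge_le G"
      "({v2, v3}, {v4, v5}) \<in> edge_le G"
  shows "eo_contains G P5_1324"
proof -
  have lin: "refl_on (edges G) (edge_le G)" "antisym (edge_le G)" "trans (edge_le G)"
    "edge_le G \<subseteq> edges G \<times> edges G" "total_on (edges G) (edge_le G)"
    using G by (auto simp: edge_ordered_graph_def order_on_defs)
  define F where "F = {{v1, v2}, {v2, v3}, {v3, v4}, {v4, v5}}"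
  define K where "K = \<lparr>verts = {v1, v2, v3, v4, v5}, edges = F, edge_le = Restr (edge_le G) F\<rparr>"
  have FE: "F \<subseteq> edges G"
    using E by (auto simp: F_def)
  have "linear_order_on F (Restr (edge_le G) F)"
    unfolding order_on_defs
  proof (intro conjI)
    show "refl_on F (Restr (edge_le G) F)" "total_on F (Restr (edge_le G) F)"
      using lin(1,5) FE unfolding refl_on_def total_on_def by blast+
    show "trans (Restr (edge_le G) F)"
      using lin(3) by (rule trans_Restr)
    show "antisym (Restr (edge_le G) F)"
      by (rule antisym_subset[OF _ lin(2)]) auto
  qed auto
  then have "eo_subgraph K G"
    using G E FE dist unfolding eo_subgraph_def K_def edge_ordered_graph_def
    by (auto simp: F_def)
  moreover have "eo_isomorphic K P5_1324"
  proof -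
    define f where "f v = (if v = v1 then 0 else if v = v2 then 1 else if v = v3 then 2
      else if v = v4 then 3 else 4 :: nat)" for v
    have f: "f v1 = 0" "f v2 = 1" "f v3 = 2" "f v4 = 3" "f v5 = 4"
      using dist by (auto simp: f_def)
    have refl: "(e, e) \<in> edge_le G" if "e \<in> F" for e
      using lin(1) FE that by (auto simp: refl_on_def)
    have le': "({v1, v2}, {v2, v3}) \<in> edge_le G" "({v1, v2}, {v4, v5}) \<in> edge_le G"
      "({v3, v4}, {v4, v5}) \<in> edge_le G"
      using le lin(3) by (meson transD)+
    have anti: "(e', e) \<notin> edge_le G" if "(e, e') \<in> edge_le G" "e \<noteq> e'" for e e'
      using lin(2) that by (auto dest: antisymD)
    have ne: "{v1, v2} \<noteq> {v2, v3}" "{v1, v2} \<noteq> {v3, v4}" "{v1, v2} \<noteq> {v4, v5}"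
      "{v2, v3} \<noteq> {v3, v4}" "{v2, v3} \<noteq> {v4, v5}" "{v3, v4} \<noteq> {v4, v5}"
      using dist by (auto simp: doubleton_eq_iff)
    note nle = anti[OF le'(1) ne(1)] anti[OF le(1) ne(2)] anti[OF le'(2) ne(3)]
      anti[OF le(2) ne(4)[symmetric]] anti[OF le(3) ne(5)] anti[OF le'(3) ne(6)]
    have refls: "({v1, v2}, {v1, v2}) \<in> edge_le G" "({v2, v3}, {v2, v3}) \<in> edge_le G"
      "({v3, v4}, {v3, v4}) \<in> edge_le G" "({v4, v5}, {v4, v5}) \<in> edge_le G"
      by (rule refl, simp add: F_def)+
    have dist': "distinct [v5, v4, v3, v2, v1]"
      using dist by auto
    have "bij_betw f (verts K) (verts P5_1324)"
      unfolding bij_betw_def K_def P5_1324_simps using dist by (auto simp: f inj_on_def)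
    moreover have "\<forall>u\<in>verts K. \<forall>v\<in>verts K. {u, v} \<in> edges K \<longleftrightarrow> {f u, f v} \<in> edges P5_1324"
      unfolding K_def P5_1324_simps F_def using dist dist'
      by (simp add: f doubleton_eq_iff)
    moreover have "\<forall>e\<in>edges K. \<forall>e'\<in>edges K.
        (e, e') \<in> edge_le K \<longleftrightarrow> (f ` e, f ` e') \<in> edge_le P5_1324"
    proof -
      have K_le: "(e, e') \<in> edge_le K \<longleftrightarrow> (e, e') \<in> edge_le G" if "e \<in> F" "e' \<in> F" for e e'
        using that by (simp add: K_def)
      have im: "f ` {v1, v2} = {0, 1}" "f ` {v2, v3} = {1, 2}" "f ` {v3, v4} = {2, 3}"
        "f ` {v4, v5} = {3, 4}"
        by (simp_all add: f)
      have "\<forall>e\<in>F. \<forall>e'\<in>F. (e, e') \<in> edge_le G \<longleftrightarrow> (f ` e, f ` e') \<in> edge_le P5_1324"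
        by (simp only: F_def ball_simps im le le' nle refls simp_thms P5_1324_simps)
          (simp add: doubleton_eq_iff)
      moreover have "edges K = F"
        by (simp add: K_def)
      ultimately show ?thesis
        using K_le by simp
    qed
    ultimately show ?thesis
      unfolding eo_isomorphic_def by (intro exI[of _ f] conjI)
  qed
  ultimately show ?thesis
    unfolding eo_contains_def by (intro exI[of _ K] conjI)
qed

lemma eo_contains_P5_1324E:
  assumes "eo_contains G P5_1324"
  obtains v1 v2 v3 v4 v5 where "distinct [v1, v2, v3, v4, v5]"
    "{v1, v2} \<in> edges G" "{v2, v3} \<in> edges G" "{v3, v4} \<in> edges G" "{v4, v5} \<in> edges G"
    "({v1, v2}, {v3, v4}) \<in> edge_le G" "({v3, v4}, {v2, v3}) \<in> edge_le G"
    "({v2, v3}, {v4, v5}) \<in> edge_le G"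
proof -
  obtain K f where K: "eo_subgraph K G" and f: "bij_betw f (verts K) (verts P5_1324)"
    and adj: "\<forall>u\<in>verts K. \<forall>v\<in>verts K. {u, v} \<in> edges K \<longleftrightarrow> {f u, f v} \<in> edges P5_1324"
    and ord: "\<forall>e\<in>edges K. \<forall>e'\<in>edges K. (e, e') \<in> edge_le K \<longleftrightarrow> (f ` e, f ` e') \<in> edge_le P5_1324"
    using assms unfolding eo_contains_def eo_isomorphic_def by blast
  define g where "g = inv_into (verts K) f"
  have g: "g i \<in> verts K" "f (g i) = i" if "i \<in> {0, 1, 2, 3, 4}" for i
    using f that unfolding g_def P5_1324_simps bij_betw_def
    by (metis inv_into_into, metis f_inv_into_f)
  have fg: "f (g 0) = 0" "f (g 1) = 1" "f (g 2) = 2" "f (g 3) = 3" "f (g 4) = 4"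
    by (rule g, simp)+
  have gV: "g 0 \<in> verts K" "g 1 \<in> verts K" "g 2 \<in> verts K" "g 3 \<in> verts K" "g 4 \<in> verts K"
    by (rule g, simp)+
  have E: "{g 0, g 1} \<in> edges K" "{g 1, g 2} \<in> edges K" "{g 2, g 3} \<in> edges K" "{g 3, g 4} \<in> edges K"
    by (simp_all only: adj[rule_format, OF gV(1) gV(2)] adj[rule_format, OF gV(2) gV(3)]
        adj[rule_format, OF gV(3) gV(4)] adj[rule_format, OF gV(4) gV(5)] fg P5_1324_simps)
      auto
  have "({g 0, g 1}, {g 2, g 3}) \<in> edge_le K" "({g 2, g 3}, {g 1, g 2}) \<in> edge_le K"
    "({g 1, g 2}, {g 3, g 4}) \<in> edge_le K"
    by (simp_all only: ord[rule_format, OF E(1) E(3)] ord[rule_format, OF E(3) E(2)]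
        ord[rule_format, OF E(2) E(4)] image_insert image_empty fg P5_1324_simps) auto
  moreover have "edges K \<subseteq> edges G" "edge_le K \<subseteq> edge_le G"
    using K by (auto simp: eo_subgraph_def)
  moreover have "distinct [g 0, g 1, g 2, g 3, g 4]"
  proof -
    have "distinct (map f [g 0, g 1, g 2, g 3, g 4])"
      unfolding list.map fg by simp
    then show ?thesis
      by (simp only: distinct_map)
  qed
  ultimately show ?thesis
    using that[of "g 0" "g 1" "g 2" "g 3" "g 4"] E by blast
qed

lemma linear_order_labelling:
  assumes "finite A" "linear_order_on A r"
  obtains lab :: "'a \<Rightarrow> nat" where
    "\<And>x y. x \<in> A \<Longrightarrow> y \<in> A \<Longrightarrow> (x, y) \<in> r \<longleftrightarrow> lab x \<le> lab y"
    "\<And>x. x \<in> A \<Longrightarrow> lab x < card A"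
    "inj_on lab A"
proof -
  have lin: "refl_on A r" "antisym r" "trans r" "total_on A r"
    using assms(2) by (auto simp: order_on_defs)
  define lab where "lab x = card {z \<in> A. (z, x) \<in> r \<and> z \<noteq> x}" for x
  have less: "lab x < lab y" if "x \<in> A" "y \<in> A" "(x, y) \<in> r" "x \<noteq> y" for x y
    unfolding lab_def
  proof (rule psubset_card_mono)
    show "{z \<in> A. (z, x) \<in> r \<and> z \<noteq> x} \<subset> {z \<in> A. (z, y) \<in> r \<and> z \<noteq> y}"
      using that lin by (blast dest: transD antisymD)
  qed (use assms in auto)
  have iff: "(x, y) \<in> r \<longleftrightarrow> lab x \<le> lab y" if "x \<in> A" "y \<in> A" for x y
  proof (cases "x = y")
    case True
    then show ?thesis using lin(1) that by (auto simp: refl_on_def)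
  next
    case False
    then show ?thesis
      using less[of x y] less[of y x] lin(4) that unfolding total_on_def by force
  qed
  have "lab x < card A" if "x \<in> A" for x
    unfolding lab_def by (rule psubset_card_mono) (use assms that in auto)
  moreover have "inj_on lab A"
    using iff lin(2) by (auto simp: inj_on_def intro!: antisymD)
  ultimately show ?thesis
    using that iff by blast
qed

subsection \<open>The upper bound\<close>

lemma P5_free_card_edges_le:
  assumes G: "edge_ordered_graph G" and free: "\<not> eo_contains G P5_1324"
    and K: "(card (verts G))\<^sup>2 < 2 ^ K"
  shows "card (edges G) \<le> card (verts G) * (13 + 2 * K)"
proof -
  have finV: "finite (verts G)" and edges: "edges G \<subseteq> {e. e \<subseteq> verts G \<and> card e = 2}"
    and lin: "linear_order_on (edges G) (edge_le G)"
    using G by (auto simp: edge_ordered_graph_def)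
  have finE: "finite (edges G)"
    by (rule finite_subset[of _ "Pow (verts G)"]) (use finV edges in auto)
  have "edges G \<subseteq> (\<lambda>(u, v). {u, v}) ` (verts G \<times> verts G)"
    using edges by (force simp: card_2_iff)
  then have "card (edges G) \<le> card (verts G \<times> verts G)"
    by (intro surj_card_le) (use finV in auto)
  then have "card (edges G) \<le> (card (verts G))\<^sup>2"
    by (simp add: card_cartesian_product power2_eq_square)
  then have N: "card (edges G) < 2 ^ K"
    using K by linarith
  obtain lab :: "'a set \<Rightarrow> nat" where
    le: "\<And>e f. e \<in> edges G \<Longrightarrow> f \<in> edges G \<Longrightarrow> (e, f) \<in> edge_le G \<longleftrightarrow> lab e \<le> lab f"
    and lab: "\<And>e. e \<in> edges G \<Longrightarrow> lab e < card (edges G)" and inj: "inj_on lab (edges G)"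
    using linear_order_labelling[OF finE lin] by blast
  interpret E0: labelled_edge_set "verts G" "edges G" lab
    by unfold_locales (use finV edges inj in auto)
  define E1 where "E1 = edges G - E0.extremal"
  interpret E1: labelled_edge_set "verts G" E1 lab
    by (rule E0.labelled_edge_set_subset) (auto simp: E1_def)
  define E2 where "E2 = E1 - E1.extremal"
  interpret E2': labelled_edge_set "verts G" E2 lab
    by (rule E1.labelled_edge_set_subset) (auto simp: E2_def)
  have sub: "E1 \<subseteq> edges G" "E2 \<subseteq> E1"
    by (auto simp: E1_def E2_def)
  have above: "\<exists>w. w \<noteq> y \<and> {x, w} \<in> edges G \<and> lab d \<le> lab {x, w}" if d: "d \<in> E2" "x \<in> d" for d x y
  proof -
    obtain d' where d': "d' \<in> E1" "x \<in> d'" "lab d < lab d'"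
      using E1.nonextremal[of d x] d by (auto simp: E2_def)
    obtain p where p: "d = {x, p}"
      using E2'.edge_obtain_other d by blast
    obtain p' where p': "d' = {x, p'}"
      using E1.edge_obtain_other d' by blast
    show ?thesis
    proof (cases "p = y")
      case True
      then have "p' \<noteq> y"
        using p p' d' by auto
      then show ?thesis
        using p' d' sub by (intro exI[of _ p']) auto
    next
      case False
      then show ?thesis
        using p d sub by (intro exI[of _ p]) auto
    qed
  qed
  have below: "\<exists>w. w \<noteq> x \<and> w \<noteq> z \<and> {y, w} \<in> edges G \<and> lab {y, w} \<le> lab a"
    if a: "a \<in> E2" "y \<in> a" for a x y z
  proof -
    obtain a' where a': "a' \<in> E1" "y \<in> a'" "lab a' < lab a"
      using E1.nonextremal[of a y] a by (auto simp: E2_def)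
    obtain a'' where a'': "a'' \<in> edges G" "y \<in> a''" "lab a'' < lab a'"
      using E0.nonextremal[of a' y] a' by (auto simp: E1_def)
    obtain p where p: "a = {y, p}"
      using E2'.edge_obtain_other a by blast
    obtain p' where p': "a' = {y, p'}"
      using E1.edge_obtain_other a' by blast
    obtain p'' where p'': "a'' = {y, p''}"
      using E0.edge_obtain_other a'' by blast
    have "p \<noteq> p'" "p \<noteq> p''" "p' \<noteq> p''"
      using p p' p'' a' a'' by auto
    then obtain w where w: "w \<in> {p, p', p''}" "w \<noteq> x" "w \<noteq> z"
      by (metis insertI1 insertI2)
    then show ?thesis
      using p p' p'' a a' a'' sub by (intro exI[of _ w]) auto
  qed
  interpret E2: non_interlacing_edge_set "verts G" E2 lab
  proof unfold_locales
    fix v x y a d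
    assume c: "{v, x} \<in> E2" and b: "{v, y} \<in> E2" and cb: "lab {v, x} < lab {v, y}"
      and a: "a \<in> E2" "y \<in> a" "lab a < lab {v, x}" and d: "d \<in> E2" "x \<in> d" "lab {v, y} < lab d"
    obtain v5 where v5: "v5 \<noteq> y" "{x, v5} \<in> edges G" "lab d \<le> lab {x, v5}"
      using above[OF d(1,2)] by blast
    obtain v1 where v1: "v1 \<noteq> x" "v1 \<noteq> v5" "{y, v1} \<in> edges G" "lab {y, v1} \<le> lab a"
      using below[OF a(1,2)] by blast
    have E: "{v, x} \<in> edges G" "{v, y} \<in> edges G"
      using c b sub by auto
    have labs: "lab {y, v1} < lab {v, x}" "lab {v, y} < lab {x, v5}"
      using v1 a d v5 by linarith+
    have "v1 \<noteq> v" "v5 \<noteq> v" "x \<noteq> y"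
      using labs cb by (auto simp: insert_commute)
    moreover have "v \<noteq> x" "v \<noteq> y" "y \<noteq> v1" "x \<noteq> v5"
      using E0.edge_ne E v1 v5 by auto
    ultimately have "distinct [v1, y, v, x, v5]"
      using v1 v5 by auto
    then have "eo_contains G P5_1324"
      by (rule eo_contains_P5_1324I[OF G])
        (use E v1 v5 labs cb le in \<open>auto simp: insert_commute\<close>)
    then show False
      using free by contradiction
  qed
  have "card E2 \<le> card (verts G) * (9 + 2 * K)"
    by (rule E2.card_E_le_log[OF _ N]) (use lab sub in auto)
  moreover have "card (edges G) \<le> card E1 + 2 * card (verts G)"
    using E0.card_E_le by (simp add: E1_def)
  moreover have "card E1 \<le> card E2 + 2 * card (verts G)"
    using E1.card_E_le by (simp add: E2_def)
  ultimately show ?thesis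
    by (simp add: algebra_simps)
qed

subsection \<open>A path-free graph with many edges\<close>

lemma dvd_gap:
  fixes a b k :: nat
  assumes "k dvd a" "k dvd b" "a < b"
  shows "a + k \<le> b"
proof -
  have "k dvd b - a" "0 < b - a"
    using assms by (auto intro: dvd_diff_nat)
  then have "k \<le> b - a"
    by (rule dvd_imp_le)
  then show ?thesis
    using assms by linarith
qed

definition block_start :: "nat \<Rightarrow> nat \<Rightarrow> nat" where
  "block_start i t = i div 2 ^ t * 2 ^ t"

lemma block_start_bounds:
  assumes "odd (i div 2 ^ t)"
  shows "2 ^ t \<le> i" "block_start i t \<le> i" "i < block_start i t + 2 ^ t" "2 ^ t \<le> block_start i t"
proof -
  have "0 < i div 2 ^ t"
    using assms by (intro Nat.gr0I) auto
  then show "2 ^ t \<le> block_start i t"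
    by (simp add: block_start_def)
  show "2 ^ t \<le> i"
    using \<open>0 < i div 2 ^ t\<close> by (simp add: div_greater_zero_iff)
  have "block_start i t + i mod 2 ^ t = i"
    unfolding block_start_def by (rule div_mult_mod_eq)
  moreover have "i mod 2 ^ t < 2 ^ t"
    by simp
  ultimately show "block_start i t \<le> i" "i < block_start i t + 2 ^ t"
    by linarith+
qed

lemma power_dvd_block_start: "s \<le> t \<Longrightarrow> 2 ^ s dvd block_start i t"
  unfolding block_start_def by (intro dvd_mult le_imp_power_dvd)

lemma block_start_eq_imp:
  assumes "odd (i div 2 ^ s)" "odd (j div 2 ^ t)" "block_start i s = block_start j t"
  shows "s = t"
proof -
  have aux: "\<not> s < t" if "odd u" "u * 2 ^ s = w * 2 ^ t" for u w s t :: nat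
  proof
    assume "s < t"
    then have "(2::nat) ^ t = 2 ^ (t - s) * 2 ^ s"
      by (simp flip: power_add)
    then have "u = w * 2 ^ (t - s)"
      using that(2) by simp
    then show False
      using that(1) \<open>s < t\<close> by simp
  qed
  have "\<not> s < t" "\<not> t < s"
    using aux[of "i div 2 ^ s" s "j div 2 ^ t" t] aux[of "j div 2 ^ t" t "i div 2 ^ s" s] assms
    unfolding block_start_def by auto
  then show ?thesis by simp
qed

text \<open>The vertices \<open>x\<^sub>i\<close> and \<open>y\<^sub>j\<close> are the numbers \<open>i < N\<close> and \<open>N + j\<close>.\<close>

definition shift_edges :: "nat \<Rightarrow> nat set set" where
  "shift_edges N = {{i, N + (i - 2 ^ t)} | i t. i < N \<and> odd (i div 2 ^ t)}"

definition shift_key :: "nat \<Rightarrow> nat set \<Rightarrow> nat" where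
  "shift_key N e = (let i = Min e; s = i - (Max e - N) in i div s * s * N + i)"

definition shift_graph :: "nat \<Rightarrow> nat eograph" where
  "shift_graph n = \<lparr>verts = {..<n}, edges = shift_edges (n div 2),
     edge_le = {(e, f). e \<in> shift_edges (n div 2) \<and> f \<in> shift_edges (n div 2) \<and>
       shift_key (n div 2) e \<le> shift_key (n div 2) f}\<rparr>"

lemma shift_key_eq:
  assumes "i < N" "odd (i div 2 ^ t)"
  shows "shift_key N {i, N + (i - 2 ^ t)} = block_start i t * N + i"
proof -
  have *: "Min {i, N + (i - 2 ^ t)} = i" "Max {i, N + (i - 2 ^ t)} = N + (i - 2 ^ t)"
    using assms by auto
  have "i - (N + (i - 2 ^ t) - N) = 2 ^ t"
    using block_start_bounds(1)[OF assms(2)] by simp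
  then show ?thesis
    unfolding shift_key_def Let_def * block_start_def by simp
qed

lemma shift_key_le_imp:
  assumes "i < N" "odd (i div 2 ^ t)" "i' < N" "odd (i' div 2 ^ t')"
    "shift_key N {i, N + (i - 2 ^ t)} \<le> shift_key N {i', N + (i' - 2 ^ t')}"
  shows "block_start i t \<le> block_start i' t'"
proof (rule ccontr)
  assume "\<not> ?thesis"
  then have "Suc (block_start i' t') * N \<le> block_start i t * N"
    by (intro mult_le_mono1) simp
  then show False
    using assms by (simp add: shift_key_eq)
qed

lemma inj_on_shift_key: "inj_on (shift_key N) (shift_edges N)"
proof (rule inj_onI)
  fix e e' assume "e \<in> shift_edges N" "e' \<in> shift_edges N" and eq: "shift_key N e = shift_key N e'"
  then obtain i t i' t' where e: "i < N" "odd (i div 2 ^ t)" "e = {i, N + (i - 2 ^ t)}"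
    "i' < N" "odd (i' div 2 ^ t')" "e' = {i', N + (i' - 2 ^ t')}"
    unfolding shift_edges_def by blast
  have bs: "block_start i t = block_start i' t'"
    using shift_key_le_imp[of i N t i' t'] shift_key_le_imp[of i' N t' i t] e eq by simp
  moreover have "block_start i t * N + i = block_start i' t' * N + i'"
    using eq e by (simp add: shift_key_eq)
  ultimately have "i = i'"
    by simp
  then show "e = e'"
    using block_start_eq_imp[OF e(2,5) bs] e by simp
qed

lemma edge_ordered_shift_graph: "edge_ordered_graph (shift_graph n)"
proof -
  have "shift_edges (n div 2) \<subseteq> {e. e \<subseteq> {..<n} \<and> card e = 2}"
    unfolding shift_edges_def by auto
  moreover have "linear_order_on (edges (shift_graph n)) (edge_le (shift_graph n))"
    using inj_on_shift_key[of "n div 2"]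
    by (auto simp: order_on_defs shift_graph_def refl_on_def trans_def antisym_def total_on_def inj_on_def)
  ultimately show ?thesis
    by (simp add: edge_ordered_graph_def shift_graph_def)
qed

lemma shift_edges_left:
  assumes "{u, v} \<in> shift_edges N" "u < N"
  obtains t where "odd (u div 2 ^ t)" "v = N + (u - 2 ^ t)"
proof -
  obtain i t where it: "i < N" "odd (i div 2 ^ t)" "{u, v} = {i, N + (i - 2 ^ t)}"
    using assms(1) unfolding shift_edges_def by blast
  then have "u = i" "v = N + (i - 2 ^ t)"
    using assms(2) by (auto simp: doubleton_eq_iff)
  then show ?thesis
    using that it by blast
qed

lemma shift_edges_right:
  assumes "{u, v} \<in> shift_edges N" "N \<le> u"
  obtains t where "v < N" "odd (v div 2 ^ t)" "u = N + (v - 2 ^ t)"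
proof -
  obtain i t where it: "i < N" "odd (i div 2 ^ t)" "{u, v} = {i, N + (i - 2 ^ t)}"
    using assms(1) unfolding shift_edges_def by blast
  then have "v = i" "u = N + (i - 2 ^ t)"
    using assms(2) by (auto simp: doubleton_eq_iff)
  then show ?thesis
    using that it by blast
qed

lemma no_left_centre:
  assumes "odd (i div 2 ^ c)" "odd (i div 2 ^ b)" "odd (i' div 2 ^ a)"
    and "i' - 2 ^ a = i - 2 ^ b" "b \<noteq> c"
    and "block_start i' a \<le> block_start i c" "block_start i c \<le> block_start i b"
  shows False
proof -
  note bounds = block_start_bounds[OF assms(1)] block_start_bounds[OF assms(2)] block_start_bounds[OF assms(3)]
  have less: "block_start i c < block_start i b"
    using block_start_eq_imp[OF assms(1,2)] assms(5,7) by linarith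
  show False
  proof (cases "b \<le> c")
    case True
    have "block_start i c + 2 ^ b \<le> block_start i b"
      by (rule dvd_gap) (use True less power_dvd_block_start in auto)
    then show False
      using bounds assms(4,6) by linarith
  next
    case False
    have "block_start i c + 2 ^ c \<le> block_start i b"
      by (rule dvd_gap) (use False less power_dvd_block_start in auto)
    then show False
      using bounds by linarith
  qed
qed

lemma no_right_centre:
  assumes "odd (i div 2 ^ c)" "odd (i' div 2 ^ b)" "odd (i div 2 ^ d)"
    and "i' - 2 ^ b = i - 2 ^ c" "i \<noteq> i'"
    and "block_start i c \<le> block_start i' b" "block_start i' b \<le> block_start i d"
  shows False
proof -
  note bounds = block_start_bounds[OF assms(1)] block_start_bounds[OF assms(2)] block_start_bounds[OF assms(3)]
  have "b \<noteq> c"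
    using assms(4,5) bounds by auto
  then have less: "block_start i c < block_start i' b"
    using block_start_eq_imp[OF assms(1,2)] assms(6) by linarith
  show False
  proof (cases "c \<le> b")
    case True
    have "block_start i c + 2 ^ c \<le> block_start i' b"
      by (rule dvd_gap) (use True less power_dvd_block_start in auto)
    then show False
      using bounds assms(7) by linarith
  next
    case False
    have "block_start i c + 2 ^ b \<le> block_start i' b"
      by (rule dvd_gap) (use False less power_dvd_block_start in auto)
    then show False
      using bounds assms(4) by linarith
  qed
qed

lemma shift_graph_P5_free: "\<not> eo_contains (shift_graph n) P5_1324"
proof
  define N where "N = n div 2"
  assume "eo_contains (shift_graph n) P5_1324"
  then obtain v1 v2 v3 v4 v5 where dist: "distinct [v1, v2, v3, v4, v5]"
    and E: "{v1, v2} \<in> edges (shift_graph n)" "{v2, v3} \<in> edges (shift_graph n)"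
      "{v3, v4} \<in> edges (shift_graph n)" "{v4, v5} \<in> edges (shift_graph n)"
    and le: "({v1, v2}, {v3, v4}) \<in> edge_le (shift_graph n)"
      "({v3, v4}, {v2, v3}) \<in> edge_le (shift_graph n)"
      "({v2, v3}, {v4, v5}) \<in> edge_le (shift_graph n)"
    by (rule eo_contains_P5_1324E)
  have E: "{v2, v1} \<in> shift_edges N" "{v3, v2} \<in> shift_edges N"
    "{v3, v4} \<in> shift_edges N" "{v4, v5} \<in> shift_edges N"
    and le: "shift_key N {v1, v2} \<le> shift_key N {v3, v4}" "shift_key N {v3, v4} \<le> shift_key N {v3, v2}"
      "shift_key N {v3, v2} \<le> shift_key N {v4, v5}"
    using E le by (simp_all add: shift_graph_def N_def insert_commute)
  show False
  proof (cases "v3 < N")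
    case True
    obtain b where b: "odd (v3 div 2 ^ b)" "v2 = N + (v3 - 2 ^ b)"
      using shift_edges_left[OF E(2) True] by blast
    obtain c where c: "odd (v3 div 2 ^ c)" "v4 = N + (v3 - 2 ^ c)"
      using shift_edges_left[OF E(3) True] by blast
    obtain a where a: "v1 < N" "odd (v1 div 2 ^ a)" "v2 = N + (v1 - 2 ^ a)"
      using shift_edges_right[OF E(1)] b by auto
    show False
    proof (rule no_left_centre[OF c(1) b(1) a(2)])
      show "v1 - 2 ^ a = v3 - 2 ^ b" "b \<noteq> c"
        using a b c dist by auto
      show "block_start v1 a \<le> block_start v3 c"
        using shift_key_le_imp[OF a(1,2) True c(1)] le(1)
        unfolding a(3)[symmetric] c(2)[symmetric] by blast
      show "block_start v3 c \<le> block_start v3 b"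
        using shift_key_le_imp[OF True c(1) True b(1)] le(2)
        unfolding b(2)[symmetric] c(2)[symmetric] by blast
    qed
  next
    case False
    obtain b where b: "v2 < N" "odd (v2 div 2 ^ b)" "v3 = N + (v2 - 2 ^ b)"
      using shift_edges_right[OF E(2)] False by auto
    obtain c where c: "v4 < N" "odd (v4 div 2 ^ c)" "v3 = N + (v4 - 2 ^ c)"
      using shift_edges_right[OF E(3)] False by auto
    obtain d where d: "odd (v4 div 2 ^ d)" "v5 = N + (v4 - 2 ^ d)"
      using shift_edges_left[OF E(4) c(1)] by blast
    show False
    proof (rule no_right_centre[OF c(2) b(2) d(1)])
      show "v2 - 2 ^ b = v4 - 2 ^ c" "v4 \<noteq> v2"
        using b c dist by auto
      show "block_start v4 c \<le> block_start v2 b"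
        using shift_key_le_imp[OF c(1,2) b(1,2)] le(2)
        unfolding b(3)[symmetric] c(3)[symmetric] insert_commute[of v3] by blast
      show "block_start v2 b \<le> block_start v4 d"
        using shift_key_le_imp[OF b(1,2) c(1) d(1)] le(3)
        unfolding b(3)[symmetric] d(2)[symmetric] insert_commute[of v3] by blast
    qed
  qed
qed

lemma card_odd_div_ge: "N \<le> 2 * card {i. i < N \<and> odd (i div 2 ^ t)} + 2 ^ t"
proof -
  define A where "A = {i. i < N \<and> odd (i div 2 ^ t)}"
  have fin: "finite A"
    by (simp add: A_def)
  have "{..<N - 2 ^ t} \<subseteq> A \<union> (\<lambda>i. i - 2 ^ t) ` A"
  proof
    fix j assume j: "j \<in> {..<N - 2 ^ t}"
    show "j \<in> A \<union> (\<lambda>i. i - 2 ^ t) ` A"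
    proof (cases "odd (j div 2 ^ t)")
      case True
      then show ?thesis using j by (auto simp: A_def)
    next
      case False
      then have "j + 2 ^ t \<in> A"
        using j by (auto simp: A_def)
      then show ?thesis
        by (intro UnI2 image_eqI[of _ _ "j + 2 ^ t"]) auto
    qed
  qed
  then have "card {..<N - 2 ^ t} \<le> card (A \<union> (\<lambda>i. i - 2 ^ t) ` A)"
    using fin by (intro card_mono) auto
  also have "\<dots> \<le> card A + card A"
    using card_Un_le card_image_le[OF fin] add_left_mono order_trans by meson
  finally show ?thesis
    by (simp add: A_def)
qed

lemma card_shift_edges_ge:
  assumes "2 ^ T \<le> N"
  shows "T * N \<le> 4 * card (shift_edges N)"
proof -
  define A where "A t = {i. i < N \<and> odd (i div 2 ^ t)}" for t
  have A: "N \<le> 4 * card (A t)" if "t < T" for t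
  proof -
    have "(2::nat) ^ Suc t \<le> 2 ^ T"
      using that by (intro power_increasing) auto
    then have "2 * 2 ^ t \<le> N"
      using assms by simp
    then show ?thesis
      using card_odd_div_ge[of N t] by (simp add: A_def)
  qed
  have "T * N = (\<Sum>t<T. N)"
    by simp
  also have "\<dots> \<le> (\<Sum>t<T. 4 * card (A t))"
    using A by (intro sum_mono) auto
  also have "\<dots> = 4 * card (SIGMA t:{..<T}. A t)"
    by (simp add: sum_distrib_left A_def)
  also have "card (SIGMA t:{..<T}. A t) \<le> card (shift_edges N)"
  proof (rule card_inj_on_le[where f = "\<lambda>(t, i). {i, N + (i - 2 ^ t)}"])
    show "inj_on (\<lambda>(t, i). {i, N + (i - 2 ^ t)}) (SIGMA t:{..<T}. A t)"
    proof (rule inj_onI, clarsimp simp: A_def)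
      fix t i t' i'
      assume *: "i < N" "odd (i div 2 ^ t)" "i' < N" "odd (i' div 2 ^ t')"
        and "{i, N + (i - 2 ^ t)} = {i', N + (i' - 2 ^ t')}"
      then have "i = i'" "i - 2 ^ t = i' - 2 ^ t'"
        by (auto simp: doubleton_eq_iff)
      moreover have "2 ^ t \<le> i" "2 ^ t' \<le> i'"
        using block_start_bounds(1) * by auto
      ultimately have "(2::nat) ^ t = 2 ^ t'"
        by linarith
      then show "t = t' \<and> i = i'"
        using \<open>i = i'\<close> by simp
    qed
    show "(\<lambda>(t, i). {i, N + (i - 2 ^ t)}) ` (SIGMA t:{..<T}. A t) \<subseteq> shift_edges N"
      unfolding shift_edges_def A_def by (rule image_subsetI) (clarsimp, blast)
    show "finite (shift_edges N)"
      by (rule finite_subset[of _ "Pow {..<2 * N}"]) (auto simp: shift_edges_def)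
  qed
  finally show ?thesis by simp
qed

subsection \<open>Asymptotics\<close>

lemma ex_eo_P5_1324_attained:
  obtains G :: "nat eograph" where "edge_ordered_graph G" "card (verts G) = n"
    "\<not> eo_contains G P5_1324" "card (edges G) = ex_eo n P5_1324"
proof -
  have "edge_ordered_graph P5_1324" "edges P5_1324 \<noteq> {}"
    by (rule edge_ordered_graph_labelled_path, simp) (simp only: P5_1324_simps insert_not_empty simp_thms)
  then have "ex_eo n P5_1324 \<in> H_free_edge_counts n P5_1324"
    unfolding ex_eo_def by (intro Max_in finite_H_free_edge_counts H_free_edge_counts_nonempty)
  then obtain G :: "nat eograph" where "ex_eo n P5_1324 = card (edges G)" "edge_ordered_graph G"
    "card (verts G) = n" "\<not> eo_contains G P5_1324"
    unfolding H_free_edge_counts_def by blast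
  then show ?thesis
    using that[of G] by simp
qed

lemma ex_eo_P5_1324_le:
  assumes "2 \<le> n"
  shows "real (ex_eo n P5_1324) \<le> 42 * (real n * ln (real n))"
proof -
  obtain T where T: "2 ^ T \<le> n" "n < 2 ^ (T + 1)"
    using ex_power_ivl1[of 2 n] assms by auto
  obtain G :: "nat eograph" where G: "edge_ordered_graph G" "card (verts G) = n"
    "\<not> eo_contains G P5_1324" "card (edges G) = ex_eo n P5_1324"
    by (rule ex_eo_P5_1324_attained)
  have "n\<^sup>2 < (2 ^ (T + 1))\<^sup>2"
    using T by (intro power_strict_mono) auto
  also have "\<dots> = 2 ^ (2 * (T + 1))"
    by (simp add: power_mult[symmetric] mult.commute)
  finally have "ex_eo n P5_1324 \<le> n * (13 + 2 * (2 * (T + 1)))"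
    using P5_free_card_edges_le[OF G(1,3)] G(2,4) by metis
  also have "\<dots> = n * (17 + 4 * T)"
    by simp
  finally have "real (ex_eo n P5_1324) \<le> real (n * (17 + 4 * T))"
    by (simp only: of_nat_le_iff)
  also have "\<dots> = real n * (17 + 4 * real T)"
    by simp
  also have "\<dots> \<le> real n * (42 * ln (real n))"
  proof (intro mult_left_mono)
    have ln2: "1 / 2 \<le> ln (2::real)"
      using ln_le_minus_one[of "1 / 2 :: real"] by (simp add: ln_div)
    have "ln (2 ^ T) \<le> ln (real n)"
      using T(1) assms by (subst ln_le_cancel_iff) (auto simp flip: of_nat_le_iff)
    then have "real T * ln 2 \<le> ln (real n)"
      by (simp add: ln_realpow)
    moreover have "real T * (1 / 2) \<le> real T * ln 2"
      using ln2 by (intro mult_left_mono) auto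
    moreover have "ln 2 \<le> ln (real n)"
      using assms by simp
    ultimately show "17 + 4 * real T \<le> 42 * ln (real n)"
      using ln2 by linarith
  qed simp
  finally show ?thesis
    by (simp add: mult_ac)
qed

lemma ex_eo_P5_1324_ge:
  assumes "4 \<le> n"
  shows "real n * ln (real n) \<le> 36 * real (ex_eo n P5_1324)"
proof -
  define N where "N = n div 2"
  have N: "2 \<le> N" "n \<le> 3 * N" "n < 2 * (N + 1)"
    using assms unfolding N_def by presburger+
  obtain T where T: "2 ^ T \<le> N" "N < 2 ^ (T + 1)"
    using ex_power_ivl1[of 2 N] N by auto
  have "T \<noteq> 0"
    using T(2) N(1) by (intro notI) simp
  have card_verts: "card (verts (shift_graph n)) = n"
    by (simp add: shift_graph_def)
  have "card (edges (shift_graph n)) \<in> H_free_edge_counts n P5_1324"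
    unfolding H_free_edge_counts_def mem_Collect_eq
    by (rule exI[of _ "shift_graph n"])
      (use edge_ordered_shift_graph[of n] shift_graph_P5_free[of n] card_verts in simp)
  then have "card (edges (shift_graph n)) \<le> ex_eo n P5_1324"
    unfolding ex_eo_def by (intro Max_ge finite_H_free_edge_counts)
  then have "T * N \<le> 4 * ex_eo n P5_1324"
    using card_shift_edges_ge[OF T(1)] by (simp add: shift_graph_def N_def)
  then have ex: "real T * real N \<le> 4 * real (ex_eo n P5_1324)"
    by (metis of_nat_le_iff of_nat_mult of_nat_numeral)
  have "n \<le> 2 ^ (T + 2)"
    using N T by simp
  then have "real n \<le> 2 ^ (T + 2)"
    by (metis of_nat_le_iff of_nat_numeral of_nat_power)
  then have "ln (real n) \<le> ln (2 ^ (T + 2))"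
    using assms by (subst ln_le_cancel_iff) auto
  also have "\<dots> = (real T + 2) * ln 2"
    by (subst ln_realpow) simp_all
  also have "\<dots> \<le> (real T + 2) * 1"
    using ln_2_less_1 by (intro mult_left_mono) auto
  also have "\<dots> \<le> 3 * real T"
    using \<open>T \<noteq> 0\<close> by simp
  finally have "real n * ln (real n) \<le> (3 * real N) * (3 * real T)"
    using N(2) assms by (intro mult_mono) auto
  also have "\<dots> \<le> 36 * real (ex_eo n P5_1324)"
    using ex by (simp add: mult_ac)
  finally show ?thesis .
qed

theorem theorem4p14:
  shows "(\<lambda>n. real (ex_eo n (labelled_path [1, 3, 2, 4]))) \<in> \<Theta>(\<lambda>n. real n * ln (real n))"
proof (rule bigthetaI)
  show "(\<lambda>n. real (ex_eo n P5_1324)) \<in> O(\<lambda>n. real n * ln (real n))"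
  proof (rule bigoI)
    show "\<forall>\<^sub>F n in sequentially. norm (real (ex_eo n P5_1324)) \<le> 42 * norm (real n * ln (real n))"
      using eventually_ge_at_top[of 2] by eventually_elim (use ex_eo_P5_1324_le in auto)
  qed
  have "(\<lambda>n. real n * ln (real n)) \<in> O(\<lambda>n. real (ex_eo n P5_1324))"
  proof (rule bigoI)
    show "\<forall>\<^sub>F n in sequentially. norm (real n * ln (real n)) \<le> 36 * norm (real (ex_eo n P5_1324))"
      using eventually_ge_at_top[of 4] by eventually_elim (use ex_eo_P5_1324_ge in auto)
  qed
  then show "(\<lambda>n. real (ex_eo n P5_1324)) \<in> \<Omega>(\<lambda>n. real n * ln (real n))"
    by (simp add: bigomega_iff_bigo)
qed

end
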